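(* Let $n\geq 5$ and let $G\in\mathfrak{C}_{n,n-3}$, i.e. $G$ is a connected graph on $n$ vertices with exactly $n-3$ cut vertices. Then $\varepsilon(G)\leq \varepsilon(U_{n,3}^l)$.
   Context: All graphs are finite, simple, connected and undirected. The eccentricity of a vertex $v$ of $G$ is $e_G(v)=\max\{d_G(v,u): u\in V(G)\}$, and the total eccentricity index is $\varepsilon(G)=\sum_{v\in V(G)}e_G(v)$. A vertex $w$ is a cut vertex of $G$ if $G-w$ is disconnected. $\mathfrak{C}_{n,s}$ is the set of all connected graphs on $n$ vertices with exactly $s$ cut vertices. For $3\leq g\leq n-1$, $U_{n,g}^l$ is the unicyclic graph on $n$ vertices obtained by joining one end vertex of the path $P_{n-g}$ on $n-g$ vertices to a vertex of the cycle $C_g$ by an edge (the superscript $l$ is part of the name, not a variable). *)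

theory Defs
  imports "Graph_Theory.Graph_Theory"
begin

text \<open>
  A finite simple undirected graph is a \<^locale>\<open>graph\<close>: a finite digraph without
  loops or parallel arcs and with a symmetric adjacency relation, each undirected edge being
  represented by two opposite arcs.
\<close>

text \<open>Every arc has weight 1, so the cost of a walk is its number of edges.\<close>

definition graph_dist :: "('a,'b) pre_digraph \<Rightarrow> 'a \<Rightarrow> 'a \<Rightarrow> ereal" where
  "graph_dist G u v = wf_digraph.\<mu> G (\<lambda>_. 1) u v"

definition eccentricity :: "('a,'b) pre_digraph \<Rightarrow> 'a \<Rightarrow> ereal" where
  "eccentricity G v = Max {graph_dist G v u | u. u \<in> verts G}"

definition total_eccentricity :: "('a,'b) pre_digraph \<Rightarrow> ereal" where
  "total_eccentricity G = (\<Sum>v\<in>verts G. eccentricity G v)"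

text \<open>
  The library's \<^const>\<open>connected\<close> is false for the graph without vertices. The
  nonemptiness condition keeps the vertex of a one-vertex graph from being a cut vertex.
\<close>

definition cut_vertex :: "('a,'b) pre_digraph \<Rightarrow> 'a \<Rightarrow> bool" where
  "cut_vertex G w \<longleftrightarrow>
     w \<in> verts G \<and> verts (pre_digraph.del_vert G w) \<noteq> {} \<and>
     \<not> connected (pre_digraph.del_vert G w)"

definition connected_graphs_with_cut_vertices :: "nat \<Rightarrow> nat \<Rightarrow> ('a,'b) pre_digraph set" where
  "connected_graphs_with_cut_vertices n s =
     {G. graph G \<and> connected G \<and> card (verts G) = n \<and> card {w. cut_vertex G w} = s}"

text \<open>
  The graph $U_{n,g}^l$, meaningful for $3 \le g \le n-1$: the cycle is on \<open>0, \<dots>, g - 1\<close>, the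
  path on \<open>g, \<dots>, n - 1\<close>, and the edge between \<open>0\<close> and \<open>g\<close> joins them.
\<close>

definition U_edges :: "nat \<Rightarrow> nat \<Rightarrow> (nat \<times> nat) set" where
  "U_edges n g =
     {(i, (i + 1) mod g) | i. i < g} \<union> {(i, i + 1) | i. g \<le> i \<and> i + 1 < n} \<union> {(0, g)}"

definition U_graph :: "nat \<Rightarrow> nat \<Rightarrow> (nat, nat \<times> nat) pre_digraph" where
  "U_graph n g = with_proj \<lparr>pverts = {..<n}, parcs = U_edges n g \<union> (U_edges n g)\<inverse>\<rparr>"

lemma graph_U_graph:
  assumes "3 \<le> g" "g < n"
  shows "graph (U_graph n g)"
proof -
  have "pair_graph \<lparr>pverts = {..<n}, parcs = U_edges n g \<union> (U_edges n g)\<inverse>\<rparr>" (is "pair_graph ?G")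
  proof
    show w: "\<And>e. e \<in> parcs ?G \<Longrightarrow> fst e \<in> pverts ?G" "\<And>e. e \<in> parcs ?G \<Longrightarrow> snd e \<in> pverts ?G"
      using assms by (auto simp: U_edges_def mod_Suc)
    show "finite (pverts ?G)" by simp
    have "parcs ?G \<subseteq> {..<n} \<times> {..<n}" using w by force
    then show "finite (parcs ?G)" by (rule finite_subset) simp
    show "\<And>e. e \<in> parcs ?G \<Longrightarrow> fst e \<noteq> snd e"
      using assms by (auto simp: U_edges_def mod_Suc split: if_splits)
    show "symmetric ?G" by (auto simp: symmetric_def arcs_ends_def arc_to_ends_def sym_def)
  qed
  then show ?thesis unfolding U_graph_def by (rule pair_graph.pair_graphD_graph)
qed

lemma connected_U_graph:
  assumes "3 \<le> g" "g < n"
  shows "connected (U_graph n g)"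
proof -
  interpret graph "U_graph n g" using assms by (rule graph_U_graph)
  have ends: "arcs_ends (U_graph n g) = U_edges n g \<union> (U_edges n g)\<inverse>"
    by (force simp: U_graph_def arcs_ends_def arc_to_ends_def)
  have v: "verts (U_graph n g) = {..<n}" by (simp add: U_graph_def)
  have a: "0 \<rightarrow>\<^sup>*\<^bsub>U_graph n g\<^esub> i" if "i < n" for i using that
  proof (induction i)
    case 0 then show ?case by (simp add: v)
  next
    case (Suc i)
    have "Suc i = g \<or> i \<rightarrow>\<^bsub>U_graph n g\<^esub> Suc i"
      unfolding ends using Suc \<open>g<n\<close> by (cases "Suc i < g") (auto simp: U_edges_def)
    then show ?case
    proof
      assume "Suc i = g"
      then have "0 \<rightarrow>\<^bsub>U_graph n g\<^esub> Suc i" unfolding ends by (auto simp: U_edges_def)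
      then show ?thesis by (rule reachable_adjI)
    next
      assume "i \<rightarrow>\<^bsub>U_graph n g\<^esub> Suc i"
      then show ?thesis using Suc by (meson Suc_lessD reachable_adj_trans)
    qed
  qed
  have "strongly_connected (U_graph n g)"
    using a assms by (auto simp: strongly_connected_def v intro: reachable_trans symmetric_reachable[OF sym_arcs])
  then show ?thesis
    unfolding connected_conv strongly_connected_def reachable_def symcl_def
    by (meson Un_upper1 order_refl rtrancl_on_mono)
qed

end

theory Submission
  imports Defs
begin

text \<open>
  Let a connected graph on \<open>n\<close> vertices have exactly three vertices that are not cut
  vertices. A vertex at maximal distance from some other vertex is never a cut vertex, because a vertex behind it would be farther away. Hence
  the ends \<open>a\<close>, \<open>b\<close> of a diametral path are two of the three, say with third one \<open>c\<close>, and the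
  eccentricity of any vertex is its largest distance to \<open>a\<close>, \<open>b\<close> and \<open>c\<close>.

  Let \<open>D\<close> be the diameter and let \<open>x i\<close> be the vertex at distance \<open>i\<close> from \<open>a\<close> on the path. If
  \<open>0 < i < D\<close> and \<open>x i \<noteq> c\<close>, then \<open>x i\<close> is a cut vertex. Every component left by its removal
  contains a non-cut vertex of the whole graph, so \<open>x i\<close> separates \<open>c\<close> from \<open>a\<close> or from \<open>b\<close>
  (\<open>gdist_third_noncut\<close>). A shortest path from \<open>c\<close> to that end passes through \<open>x i\<close> and has at
  most \<open>D\<close> edges, so \<open>c\<close> is no farther from \<open>x i\<close> than the other end of the diametral path is. The
  path therefore contributes no more than a path on \<open>D + 1\<close> vertices has as its own total
  eccentricity, \<open>path_total D\<close>. Each of the remaining \<open>n - 1 - D\<close> vertices contributes at most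
  \<open>D\<close>.

  Removing \<open>c\<close> leaves a connected graph on \<open>n - 1\<close> vertices, whence \<open>D \<le> n - 2\<close>. Lengthening a path
  on \<open>D + 1\<close> vertices by one raises its total eccentricity by at least \<open>D + 1\<close>, more than what a
  vertex off the path contributes. The bound is thus largest for \<open>D = n - 2\<close>, where it is
  \<open>path_total (n - 2) + (n - 2)\<close> (\<open>total_ecc_le\<close>). The extremal graph reaches it: it is a path on
  \<open>n - 1\<close> vertices together with one more vertex of eccentricity \<open>n - 2\<close>
  (\<open>total_eccentricity_U_graph\<close>).
\<close>

section \<open>Distances in a finite connected symmetric relation\<close>

text \<open>
  The adjacency relation of the graph without \<open>w\<close>. As it has no pair with \<open>w\<close>, its reflexive
  transitive closure connects \<open>w\<close> to nothing but itself.
\<close>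

definition avoiding :: "('a \<times> 'a) set \<Rightarrow> 'a \<Rightarrow> ('a \<times> 'a) set" where
  "avoiding E w = E \<inter> (- {w}) \<times> (- {w})"

text \<open>
  The argument uses only adjacency and natural-number distances, so it is carried out for a
  relation on vertices. The empty vertex set is admitted, which lets the removal of a vertex be
  described by the same locale.
\<close>

locale connected_relation =
  fixes V :: "'a set" and E :: "('a \<times> 'a) set"
  assumes finite_V: "finite V"
    and E_subset: "E \<subseteq> V \<times> V"
    and sym_E: "sym E"
    and conn: "\<And>u v. u \<in> V \<Longrightarrow> v \<in> V \<Longrightarrow> (u, v) \<in> E\<^sup>*"

definition gdist :: "('a \<times> 'a) set \<Rightarrow> 'a \<Rightarrow> 'a \<Rightarrow> nat" where
  "gdist E u v = (LEAST k. (u, v) \<in> E ^^ k)"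

definition ecc :: "'a set \<Rightarrow> ('a \<times> 'a) set \<Rightarrow> 'a \<Rightarrow> nat" where
  "ecc V E v = Max (gdist E v ` V)"

definition noncut :: "'a set \<Rightarrow> ('a \<times> 'a) set \<Rightarrow> 'a \<Rightarrow> bool" where
  "noncut V E w \<longleftrightarrow> w \<in> V \<and> connected_relation (V - {w}) (avoiding E w)"

lemma gdist_le: "(u, v) \<in> E ^^ k \<Longrightarrow> gdist E u v \<le> k"
  unfolding gdist_def by (rule Least_le)

lemma gdist_self [simp]: "gdist E u u = 0"
  using gdist_le[where u = u and v = u and E = E and k = 0] by simp

lemma relpow_sym:
  assumes "sym E" "(u, v) \<in> E ^^ k"
  shows "(v, u) \<in> E ^^ k"
  using assms(2)
proof (induction k arbitrary: v)
  case (Suc k)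
  then obtain y where "(u, y) \<in> E ^^ k" "(y, v) \<in> E" by auto
  then show ?case using Suc.IH symD[OF assms(1)] by (meson relpow_Suc_I2)
qed simp

lemma relpow_avoiding_subset: "(u, v) \<in> (avoiding E w) ^^ k \<Longrightarrow> (u, v) \<in> E ^^ k"
  by (induction k arbitrary: v) (auto simp: avoiding_def)

lemma sym_avoiding: "sym E \<Longrightarrow> sym (avoiding E w)"
  by (auto simp: avoiding_def sym_def)

text \<open>
  Cutting a walk at a visit to \<open>w\<close> keeps the total length; this is what turns the triangle
  inequality through a separating vertex into an equality.
\<close>

lemma relpow_avoiding_or_through:
  assumes "(u, v) \<in> E ^^ k" "u \<noteq> w"
  shows "(u, v) \<in> (avoiding E w)\<^sup>* \<or> (\<exists>i\<le>k. (u, w) \<in> E ^^ i \<and> (w, v) \<in> E ^^ (k - i))"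
  using assms(1)
proof (induction k arbitrary: v)
  case (Suc k)
  then obtain y where y: "(u, y) \<in> E ^^ k" "(y, v) \<in> E" by auto
  show ?case
  proof (cases "v = w")
    case True
    then have "(u, w) \<in> E ^^ Suc k" "(w, v) \<in> E ^^ (Suc k - Suc k)" using Suc.prems by auto
    then show ?thesis by blast
  next
    case False
    from Suc.IH[OF y(1)] show ?thesis
    proof
      assume r: "(u, y) \<in> (avoiding E w)\<^sup>*"
      have "y \<noteq> w" using r \<open>u \<noteq> w\<close> by (cases rule: rtranclE) (auto simp: avoiding_def)
      then have "(y, v) \<in> avoiding E w" using y False by (auto simp: avoiding_def)
      then show ?thesis using r by auto
    next
      assume "\<exists>i\<le>k. (u, w) \<in> E ^^ i \<and> (w, y) \<in> E ^^ (k - i)"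
      then obtain i where i: "i \<le> k" "(u, w) \<in> E ^^ i" "(w, y) \<in> E ^^ (k - i)" by auto
      then have "(w, v) \<in> E ^^ (Suc k - i)" using y(2) by (auto simp: Suc_diff_le)
      then show ?thesis using i by (meson le_Suc_eq)
    qed
  qed
qed simp

context connected_relation
begin

lemma gdist_relpow: "u \<in> V \<Longrightarrow> v \<in> V \<Longrightarrow> (u, v) \<in> E ^^ gdist E u v"
  unfolding gdist_def using conn[of u v] by (auto simp: rtrancl_is_UN_relpow intro: LeastI)

lemma gdist_sym: "u \<in> V \<Longrightarrow> v \<in> V \<Longrightarrow> gdist E u v = gdist E v u"
  by (meson gdist_le gdist_relpow relpow_sym[OF sym_E] order_antisym)

lemma gdist_triangle:
  assumes "u \<in> V" "v \<in> V" "w \<in> V"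
  shows "gdist E u w \<le> gdist E u v + gdist E v w"
proof -
  have "(u, w) \<in> E ^^ (gdist E u v + gdist E v w)"
    unfolding relpow_add using gdist_relpow assms by blast
  then show ?thesis by (rule gdist_le)
qed

lemma gdist_eq_0: "u \<in> V \<Longrightarrow> v \<in> V \<Longrightarrow> gdist E u v = 0 \<longleftrightarrow> u = v"
  using gdist_relpow[of u v] by auto

lemma gdist_split:
  assumes "u \<in> V" "v \<in> V" "i \<le> gdist E u v"
  obtains w where "w \<in> V" "gdist E u w = i" "gdist E w v = gdist E u v - i"
proof -
  have "(u, v) \<in> E ^^ (i + (gdist E u v - i))" using gdist_relpow[OF assms(1,2)] assms(3) by simp
  then obtain w where w: "(u, w) \<in> E ^^ i" "(w, v) \<in> E ^^ (gdist E u v - i)"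
    unfolding relpow_add by blast
  have "w \<in> V"
    using w(1) assms(1) E_subset by (cases i) auto
  moreover have "gdist E u w \<le> i" "gdist E w v \<le> gdist E u v - i" using w by (auto intro: gdist_le)
  moreover have "gdist E u v \<le> gdist E u w + gdist E w v"
    using gdist_triangle assms \<open>w \<in> V\<close> by blast
  ultimately show ?thesis using that[of w] assms(3) by linarith
qed

text \<open>
  Walking along a shortest path, the distance from \<open>u\<close> takes every value from 0 to its length, and
  different values need different vertices.
\<close>

lemma gdist_less_card:
  assumes "u \<in> V" "v \<in> V"
  shows "gdist E u v < card V"
proof -
  have "{..gdist E u v} \<subseteq> gdist E u ` V"
  proof
    fix i assume "i \<in> {..gdist E u v}"
    then obtain w where "w \<in> V" "gdist E u w = i" using gdist_split[OF assms] by blast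
    then show "i \<in> gdist E u ` V" by blast
  qed
  then have "card {..gdist E u v} \<le> card V" using finite_V by (rule surj_card_le[rotated])
  then show ?thesis by simp
qed

text \<open>
  The triangle inequality through a separating vertex is an equality, since a shortest path has to
  visit that vertex. All statements on cut vertices below use separation in this metric form.
\<close>

lemma gdist_separated:
  assumes "u \<in> V" "v \<in> V" "w \<in> V" "u \<noteq> w" "(u, v) \<notin> (avoiding E w)\<^sup>*"
  shows "gdist E u v = gdist E u w + gdist E w v"
proof -
  obtain i where "i \<le> gdist E u v" "(u, w) \<in> E ^^ i" "(w, v) \<in> E ^^ (gdist E u v - i)"
    using relpow_avoiding_or_through[OF gdist_relpow[OF assms(1,2)] assms(4)] assms(5) by blast
  then have "gdist E u w + gdist E w v \<le> gdist E u v" using gdist_le by (metis add_mono le_add_diff_inverse)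
  then show ?thesis using gdist_triangle assms by (simp add: order_antisym)
qed

text \<open>
  If every vertex other than \<open>x\<close> has a shortest path from \<open>r\<close> that does not visit \<open>x\<close>, all of them
  stay connected through \<open>r\<close> when \<open>x\<close> is removed.
\<close>

lemma noncut_if_nothing_behind:
  assumes "x \<in> V" "r \<in> V" "x \<noteq> r"
    and "\<And>u. u \<in> V \<Longrightarrow> u \<noteq> x \<Longrightarrow> gdist E r u \<noteq> gdist E r x + gdist E x u"
  shows "noncut V E x"
  unfolding noncut_def
proof (intro conjI connected_relation.intro)
  fix u v assume uv: "u \<in> V - {x}" "v \<in> V - {x}"
  have r: "(r, z) \<in> (avoiding E x)\<^sup>*" if "z \<in> V - {x}" for z
    using gdist_separated[of r z x] assms that by blast
  have "sym ((avoiding E x)\<^sup>*)" by (intro sym_rtrancl sym_avoiding sym_E)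
  then show "(u, v) \<in> (avoiding E x)\<^sup>*" using r[OF uv(1)] r[OF uv(2)]
    by (meson rtrancl_trans symD)
qed (use assms finite_V E_subset sym_avoiding[OF sym_E] in \<open>auto simp: avoiding_def\<close>)

lemma farthest_noncut:
  assumes "x \<in> V" "v \<in> V" "x \<noteq> v" "\<And>u. u \<in> V \<Longrightarrow> gdist E v u \<le> gdist E v x"
  shows "noncut V E x"
proof (rule noncut_if_nothing_behind[OF assms(1-3)])
  fix u assume "u \<in> V" "u \<noteq> x"
  then show "gdist E v u \<noteq> gdist E v x + gdist E x u"
    using assms(4)[of u] gdist_eq_0[of x u] assms(1) by auto
qed

text \<open>
  In the component of \<open>x\<close> after the removal of \<open>w\<close>, a vertex \<open>y\<close> farthest from \<open>w\<close> is not a cut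
  vertex: nothing in the component is farther, and vertices outside it are reached from \<open>w\<close> without
  entering the component.
\<close>

lemma noncut_in_component:
  assumes "x \<in> V" "w \<in> V" "x \<noteq> w"
  obtains y where "noncut V E y" "y \<noteq> w" "(x, y) \<in> (avoiding E w)\<^sup>*"
proof -
  define C where "C = {y \<in> V - {w}. (x, y) \<in> (avoiding E w)\<^sup>*}"
  have "finite C" "x \<in> C" using finite_V assms by (auto simp: C_def)
  then have "Max (gdist E w ` C) \<in> gdist E w ` C" by (intro Max_in) auto
  then obtain y where y: "y \<in> C" "gdist E w y = Max (gdist E w ` C)" by auto
  have far: "gdist E w u \<le> gdist E w y" if "u \<in> C" for u
    unfolding y(2) using that \<open>finite C\<close> by simp
  have yV: "y \<in> V" "y \<noteq> w" using y by (auto simp: C_def)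
  have "noncut V E y"
  proof (rule noncut_if_nothing_behind[OF yV(1) assms(2) yV(2)])
    fix u assume u: "u \<in> V" "u \<noteq> y"
    have pos: "gdist E y u > 0" "gdist E w y > 0"
      using gdist_eq_0[of y u] gdist_eq_0[of w y] u yV assms by auto
    show "gdist E w u \<noteq> gdist E w y + gdist E y u"
    proof (cases "u \<in> C")
      case True
      then show ?thesis using far[of u] pos by simp
    next
      case False
      show ?thesis
      proof (cases "u = w")
        case True
        then show ?thesis using pos by simp
      next
        case False
        then have "(y, u) \<notin> (avoiding E w)\<^sup>*"
          using \<open>u \<notin> C\<close> u y(1) unfolding C_def by (auto dest: rtrancl_trans)
        then have "gdist E y u = gdist E y w + gdist E w u"
          using gdist_separated[of y u w] u yV assms(2) by blast
        then show ?thesis using pos by simp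
      qed
    qed
  qed
  then show ?thesis using that y(1) by (auto simp: C_def)
qed

lemma gdist_le_ecc: "u \<in> V \<Longrightarrow> gdist E v u \<le> ecc V E v"
  unfolding ecc_def using finite_V by simp

lemma ecc_attained:
  assumes "v \<in> V" "card V \<ge> 2"
  obtains y where "noncut V E y" "ecc V E v = gdist E v y" "y \<noteq> v"
proof -
  have "Max (gdist E v ` V) \<in> gdist E v ` V" using finite_V assms by (intro Max_in) auto
  then obtain y where y: "y \<in> V" "ecc V E v = gdist E v y" unfolding ecc_def by auto
  have "\<not> V \<subseteq> {v}" using assms(2) card_mono[of "{v}" V] by auto
  then obtain z where z: "z \<in> V" "z \<noteq> v" by auto
  have "gdist E v z > 0" using gdist_eq_0[of v z] z assms by auto
  then have "y \<noteq> v" using gdist_le_ecc[OF z(1), of v] y by auto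
  moreover have "noncut V E y"
    using farthest_noncut[OF y(1) assms(1) \<open>y \<noteq> v\<close>] gdist_le_ecc y(2) by metis
  ultimately show ?thesis using that y by blast
qed

text \<open>
  The removal of \<open>c\<close> leaves one vertex less and can only increase distances.
\<close>

lemma gdist_avoiding_noncut:
  assumes "noncut V E c" "a \<in> V - {c}" "b \<in> V - {c}"
  shows "gdist E a b \<le> card V - 2"
proof -
  interpret del: connected_relation "V - {c}" "avoiding E c" using assms(1) by (simp add: noncut_def)
  have "(a, b) \<in> E ^^ gdist (avoiding E c) a b"
    using del.gdist_relpow[OF assms(2,3)] by (rule relpow_avoiding_subset)
  then have "gdist E a b \<le> gdist (avoiding E c) a b" by (rule gdist_le)
  also have "\<dots> < card (V - {c})" by (rule del.gdist_less_card[OF assms(2,3)])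
  also have "card (V - {c}) = card V - 1" using assms(1) finite_V by (simp add: noncut_def)
  finally show ?thesis by linarith
qed

section \<open>Three non-cut vertices\<close>

text \<open>
  The removal of the cut vertex \<open>w\<close> leaves at least two components, each with at least one of the three
  non-cut vertices. So \<open>c\<close> cannot be in one component with both \<open>a\<close> and \<open>b\<close>.
\<close>

lemma gdist_third_noncut:
  assumes nc: "{w. noncut V E w} = {a, b, c}" and w: "w \<in> V" "w \<notin> {a, b, c}"
  shows "gdist E c a = gdist E c w + gdist E w a \<or> gdist E c b = gdist E c w + gdist E w b"
proof -
  let ?R = "(avoiding E w)\<^sup>*"
  have V: "a \<in> V" "b \<in> V" "c \<in> V" using nc by (auto simp: noncut_def)
  have symR: "sym ?R" by (intro sym_rtrancl sym_avoiding sym_E)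
  have "\<not> connected_relation (V - {w}) (avoiding E w)" using nc w by (auto simp: noncut_def)
  then obtain u v where uv: "u \<in> V - {w}" "v \<in> V - {w}" "(u, v) \<notin> ?R"
    using finite_V E_subset sym_avoiding[OF sym_E]
    unfolding connected_relation_def by (auto simp: avoiding_def)
  obtain y where y: "y \<in> {a, b, c}" "(u, y) \<in> ?R"
    using noncut_in_component[of u w] uv w nc by (metis DiffE mem_Collect_eq singletonI)
  obtain z where z: "z \<in> {a, b, c}" "(v, z) \<in> ?R"
    using noncut_in_component[of v w] uv w nc by (metis DiffE mem_Collect_eq singletonI)
  have "(c, a) \<notin> ?R \<or> (c, b) \<notin> ?R"
  proof (rule ccontr)
    assume "\<not> ?thesis"
    then have "(c, y) \<in> ?R" "(c, z) \<in> ?R" using y z by auto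
    then have "(u, v) \<in> ?R" using y z symR by (meson rtrancl_trans symD)
    then show False using uv by simp
  qed
  then show ?thesis using gdist_separated[of c _ w] V w by auto
qed

end

text \<open>
  The total eccentricity of a path with \<open>D\<close> edges.
\<close>

definition path_total :: "nat \<Rightarrow> nat" where
  "path_total D = (\<Sum>i\<le>D. max i (D - i))"

text \<open>
  Adding a vertex in front of a path shifts the indices by one: the new vertex has eccentricity
  \<open>D + 1\<close> and no other eccentricity decreases.
\<close>

lemma path_total_Suc: "path_total D + Suc D \<le> path_total (Suc D)"
proof -
  have "path_total D \<le> (\<Sum>i\<le>D. max (Suc i) (D - i))"
    unfolding path_total_def by (rule sum_mono) auto
  moreover have "path_total (Suc D) = Suc D + (\<Sum>i\<le>D. max (Suc i) (D - i))"
    unfolding path_total_def by (subst sum.atMost_Suc_shift) simp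
  ultimately show ?thesis by simp
qed

lemma path_total_add: "path_total D + m * D \<le> path_total (D + m)"
proof (induction m)
  case (Suc m)
  then show ?case using path_total_Suc[of "D + m"] by simp
qed simp

lemma (in connected_relation) total_ecc_le:
  assumes "card {w. noncut V E w} = 3"
  shows "(\<Sum>v\<in>V. ecc V E v) \<le> path_total (card V - 2) + (card V - 2)"
proof -
  have "{w. noncut V E w} \<subseteq> V" by (auto simp: noncut_def)
  then have card3: "card V \<ge> 3" using card_mono[OF finite_V] assms by metis
  then have card2: "card V \<ge> 2" and "V \<noteq> {}" by auto
  have "Max (ecc V E ` V) \<in> ecc V E ` V" using finite_V \<open>V \<noteq> {}\<close> by (intro Max_in) auto
  then obtain a where a: "a \<in> V" "ecc V E a = Max (ecc V E ` V)" by auto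
  obtain b where b: "noncut V E b" "ecc V E a = gdist E a b" "b \<noteq> a"
    using ecc_attained[OF a(1) card2] .
  have bV: "b \<in> V" using b(1) by (simp add: noncut_def)
  define D where "D = gdist E a b"
  have ecc_le: "ecc V E v \<le> D" if "v \<in> V" for v
    using that a(2) b(2) finite_V unfolding D_def by simp
  have diam: "gdist E u v \<le> D" if "u \<in> V" "v \<in> V" for u v
    using gdist_le_ecc[OF that(2), of u] ecc_le[OF that(1)] by simp
  have aN: "noncut V E a"
    using farthest_noncut[OF a(1) bV] b(3) diam[OF bV] gdist_sym[OF a(1) bV] unfolding D_def by auto
  have "\<exists>c. {w. noncut V E w} = {a, b, c} \<and> c \<noteq> a \<and> c \<noteq> b"
  proof -
    obtain p q r where "{w. noncut V E w} = {p, q, r}" "p \<noteq> q" "p \<noteq> r" "q \<noteq> r"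
      using assms by (auto simp: card_3_iff)
    moreover from this have "a \<in> {p, q, r}" "b \<in> {p, q, r}" using aN b(1) by auto
    ultimately show ?thesis using b(3) by (auto simp: insert_commute)
  qed
  then obtain c where nc: "{w. noncut V E w} = {a, b, c}" and c: "c \<noteq> a" "c \<noteq> b" by auto
  have cN: "noncut V E c" using nc by auto
  then have cV: "c \<in> V" by (simp add: noncut_def)
  have Dle: "D \<le> card V - 2"
    unfolding D_def using gdist_avoiding_noncut[OF cN] a(1) bV c by auto
  have "\<forall>i\<in>{..D}. \<exists>w. w \<in> V \<and> gdist E a w = i \<and> gdist E w b = D - i"
    using gdist_split[OF a(1) bV] unfolding D_def by (metis atMost_iff)
  then obtain x where x: "\<And>i. i \<le> D \<Longrightarrow> x i \<in> V \<and> gdist E a (x i) = i \<and> gdist E (x i) b = D - i"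
    by (metis atMost_iff)
  have inj: "inj_on x {..D}" by (rule inj_on_inverseI[of _ "gdist E a"]) (use x in auto)
  have ecc_x: "ecc V E (x i) \<le> max i (D - i)" if i: "i \<le> D" for i
  proof -
    have xi: "x i \<in> V" "gdist E (x i) a = i" "gdist E (x i) b = D - i"
      using x[OF i] gdist_sym[OF a(1)] by auto
    have "gdist E (x i) c \<le> max i (D - i)"
    proof (cases "x i \<in> {a, b, c}")
      case True
      \<comment> \<open>At the ends \<open>max i (D - i)\<close> is the diameter, and \<open>c\<close> has distance 0 from itself.\<close>
      then have "i = 0 \<or> i = D \<or> x i = c" using xi x[OF i] i gdist_eq_0 by auto
      then show ?thesis using diam[OF xi(1) cV] by auto
    next
      case False
      then have "gdist E c (x i) + i \<le> D \<or> gdist E c (x i) + (D - i) \<le> D"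
        using gdist_third_noncut[OF nc xi(1)] diam[OF cV a(1)] diam[OF cV bV] xi by auto
      then show ?thesis using gdist_sym[OF cV xi(1)] i by auto
    qed
    moreover obtain y where "noncut V E y" "ecc V E (x i) = gdist E (x i) y"
      using ecc_attained[OF xi(1) card2] .
    moreover from this have "y \<in> {a, b, c}" using nc by blast
    ultimately show ?thesis using xi by auto
  qed
  let ?P = "x ` {..D}"
  have PV: "?P \<subseteq> V" using x by auto
  have cardP: "card ?P = Suc D" using inj by (simp add: card_image)
  have "(\<Sum>v\<in>V. ecc V E v) = (\<Sum>v\<in>V - ?P. ecc V E v) + (\<Sum>v\<in>?P. ecc V E v)"
    using sum.subset_diff[OF PV finite_V] .
  also have "(\<Sum>v\<in>?P. ecc V E v) = (\<Sum>i\<le>D. ecc V E (x i))" using inj by (simp add: sum.reindex)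
  also have "\<dots> \<le> path_total D" unfolding path_total_def using ecc_x by (intro sum_mono) auto
  also have "(\<Sum>v\<in>V - ?P. ecc V E v) \<le> card (V - ?P) * D"
    using sum_bounded_above[of "V - ?P" "ecc V E" D] ecc_le by auto
  also have "card (V - ?P) = Suc (card V - 2 - D)"
    using card_Diff_subset[of ?P V] PV cardP finite_V Dle card3 by auto
  \<comment> \<open>One of the \<open>D\<close>'s is split off: it is bounded by \<open>card V - 2\<close>, while the others pay for the
    growth of the path from \<open>D\<close> to \<open>card V - 2\<close> edges.\<close>
  finally have "(\<Sum>v\<in>V. ecc V E v) \<le> path_total D + (card V - 2 - D) * D + D" by simp
  also have "\<dots> \<le> path_total (card V - 2) + (card V - 2)"
    using path_total_add[of D "card V - 2 - D"] Dle by (simp only: le_add_diff_inverse add_mono)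
  finally show ?thesis .
qed

section \<open>Distances and cut vertices of graphs\<close>

lemma (in wf_digraph) awalk_imp_relpow: "awalk u p v \<Longrightarrow> (u, v) \<in> arcs_ends G ^^ length p"
proof (induction p arbitrary: u)
  case Nil
  then show ?case by (simp add: awalk_Nil_iff)
next
  case (Cons e p)
  then have "(u, head G e) \<in> arcs_ends G" "(head G e, v) \<in> arcs_ends G ^^ length p"
    by (auto simp: awalk_Cons_iff arcs_ends_conv)
  then show ?case unfolding length_Cons by (rule relpow_Suc_I2)
qed

lemma (in wf_digraph) relpow_imp_awalk:
  assumes "u \<in> verts G" "(u, v) \<in> arcs_ends G ^^ k"
  shows "\<exists>p. awalk u p v \<and> length p = k"
  using assms
proof (induction k arbitrary: u)
  case 0
  then show ?case by (simp add: awalk_Nil_iff)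
next
  case (Suc k)
  obtain y where y: "(u, y) \<in> arcs_ends G" "(y, v) \<in> arcs_ends G ^^ k"
    using Suc.prems(2) by (rule relpow_Suc_E2)
  then obtain e where e: "e \<in> arcs G" "tail G e = u" "head G e = y" by (auto simp: arcs_ends_conv)
  then obtain p where "awalk y p v" "length p = k" using Suc.IH[of y] y(2) head_in_verts by blast
  then have "awalk u (e # p) v" "length (e # p) = Suc k" using e by (simp_all add: awalk_Cons_iff)
  then show ?case by blast
qed

lemma (in wf_digraph) connected_iff_connected_relation:
  assumes "symmetric G" "finite (verts G)"
  shows "connected G \<longleftrightarrow> verts G \<noteq> {} \<and> connected_relation (verts G) (arcs_ends G)"
proof -
  have sym: "sym (arcs_ends G)" using assms(1) by (simp add: symmetric_def)
  then have symcl: "(arcs_ends G)\<^sup>s = arcs_ends G" by (auto simp: symcl_def sym_def)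
  have sub: "arcs_ends G \<subseteq> verts G \<times> verts G" by (auto simp: arcs_ends_conv)
  have "(u, v) \<in> rtrancl_on (verts G) (arcs_ends G) \<longleftrightarrow> (u, v) \<in> (arcs_ends G)\<^sup>*"
    if "u \<in> verts G" "v \<in> verts G" for u v
    using rtrancl_consistent_rtrancl_on[of u v "arcs_ends G" "verts G"] rtrancl_on_rtranclI[of u v]
      sub that by blast
  then show ?thesis using sym sub assms(2)
    unfolding connected_conv symcl connected_relation_def by auto
qed

lemma (in graph) cut_vertex_iff:
  assumes "w \<in> verts G" "card (verts G) \<ge> 2"
  shows "cut_vertex G w \<longleftrightarrow> \<not> noncut (verts G) (arcs_ends G) w"
proof -
  let ?H = "del_vert w"
  interpret H: wf_digraph ?H by (rule wf_digraph_del_vert)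
  have E: "arcs_ends ?H = avoiding (arcs_ends G) w"
    by (auto simp: arcs_ends_conv avoiding_def del_vert_simps)
  have "sym (arcs_ends G)" using sym_arcs by (simp add: symmetric_def)
  then have "symmetric ?H" unfolding symmetric_def E by (rule sym_avoiding)
  then have conn: "connected ?H \<longleftrightarrow> verts ?H \<noteq> {} \<and> connected_relation (verts ?H) (arcs_ends ?H)"
    by (rule H.connected_iff_connected_relation) (simp add: del_vert_simps)
  have "verts G \<noteq> {w}" using assms(2) by auto
  then have "verts ?H \<noteq> {}" using assms(1) by (auto simp: del_vert_simps)
  then show ?thesis
    using conn assms(1) unfolding cut_vertex_def noncut_def E by (simp add: del_vert_simps)
qed

text \<open>
  With unit weights the cost of a walk is its length, so the infimum over all walks is attained at
  the least length.
\<close>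

lemma (in graph) graph_dist_eq_gdist:
  assumes "connected G" "u \<in> verts G" "v \<in> verts G"
  shows "graph_dist G u v = ereal (real (gdist (arcs_ends G) u v))"
proof -
  interpret R: connected_relation "verts G" "arcs_ends G"
    using assms(1) connected_iff_connected_relation[OF sym_arcs finite_verts] by simp
  have cost: "awalk_cost (\<lambda>_. 1) p = real (length p)" for p by (induction p) auto
  obtain p where p: "awalk u p v" "length p = gdist (arcs_ends G) u v"
    using relpow_imp_awalk[OF assms(2) R.gdist_relpow[OF assms(2,3)]] by blast
  have "gdist (arcs_ends G) u v \<le> length q" if "awalk u q v" for q
    using awalk_imp_relpow[OF that] by (rule gdist_le)
  then have "ereal (real (gdist (arcs_ends G) u v)) \<le> graph_dist G u v"
    unfolding graph_dist_def \<mu>_def cost by (auto intro!: INF_greatest)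
  moreover have "graph_dist G u v \<le> ereal (real (gdist (arcs_ends G) u v))"
    using min_cost_le_walk_cost[OF p(1), of "\<lambda>_. 1"] p(2) by (simp add: graph_dist_def cost)
  ultimately show ?thesis by (rule order_antisym[rotated])
qed

lemma (in graph) total_eccentricity_eq:
  assumes "connected G"
  shows "total_eccentricity G = ereal (real (\<Sum>v\<in>verts G. ecc (verts G) (arcs_ends G) v))"
proof -
  have ne: "verts G \<noteq> {}" using assms by (auto simp: connected_conv)
  have "eccentricity G v = ereal (real (ecc (verts G) (arcs_ends G) v))" if "v \<in> verts G" for v
  proof -
    have "{graph_dist G v u |u. u \<in> verts G}
        = (\<lambda>u. ereal (real (gdist (arcs_ends G) v u))) ` verts G"
      unfolding Setcompr_eq_image by (intro image_cong refl graph_dist_eq_gdist assms that)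
    also have "\<dots> = (\<lambda>k. ereal (real k)) ` gdist (arcs_ends G) v ` verts G"
      by (simp only: image_image)
    finally show ?thesis unfolding eccentricity_def ecc_def
      using mono_Max_commute[of "\<lambda>k. ereal (real k)" "gdist (arcs_ends G) v ` verts G"] ne
      by (simp add: mono_def)
  qed
  then show ?thesis unfolding total_eccentricity_def by simp
qed

text \<open>
  A potential that grows by at most 1 along each edge bounds distances from below, which avoids
  computing the distances of the extremal graph.
\<close>

lemma (in connected_relation) gdist_ge_potential:
  fixes f :: "'a \<Rightarrow> nat"
  assumes "\<And>x y. (x, y) \<in> E \<Longrightarrow> f y \<le> f x + 1" "u \<in> V" "v \<in> V"
  shows "f v \<le> f u + gdist E u v"
proof -
  have "f v \<le> f u + k" if "(u, v) \<in> E ^^ k" for k v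
    using that by (induction k arbitrary: v) (auto dest!: assms(1), force)
  then show ?thesis using gdist_relpow[OF assms(2,3)] by blast
qed

text \<open>
  Let the potential be the position along the path \<open>1, 0, 3, 4, \<dots>, n - 1\<close>, with the remaining triangle
  vertex \<open>2\<close> placed at the same position as \<open>1\<close>. The distances to the two ends \<open>1\<close> and \<open>n - 1\<close>
  are at least the differences of positions.
\<close>

lemma total_eccentricity_U_graph:
  assumes "n \<ge> 5"
  shows "ereal (real (path_total (n - 2) + (n - 2))) \<le> total_eccentricity (U_graph n 3)"
proof -
  let ?U = "U_graph n 3" and ?E = "arcs_ends (U_graph n 3)"
  interpret graph ?U using assms by (intro graph_U_graph) auto
  have con: "connected ?U" using assms by (intro connected_U_graph) auto
  have V: "verts ?U = {..<n}" by (simp add: U_graph_def)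
  interpret R: connected_relation "{..<n}" ?E
    using con connected_iff_connected_relation[OF sym_arcs finite_verts] V by simp
  have E: "?E = U_edges n 3 \<union> (U_edges n 3)\<inverse>"
    by (force simp: U_graph_def arcs_ends_def arc_to_ends_def)
  define f :: "nat \<Rightarrow> nat" where "f v = (if v = 0 then 1 else if v \<le> 2 then 0 else v - 1)" for v
  have lip: "f y \<le> f x + 1" if "(x, y) \<in> ?E" for x y
    using that unfolding E U_edges_def f_def by (auto simp: mod_Suc split: if_splits)
  have lower: "max (f v) (n - 2 - f v) \<le> ecc {..<n} ?E v" if "v < n" for v
  proof -
    have "f v \<le> f 1 + gdist ?E v 1"
      using R.gdist_ge_potential[of f 1 v] R.gdist_sym[of 1 v] lip that assms by simp
    moreover have "f 1 = 0" by (simp add: f_def)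
    moreover have "f (n - 1) \<le> f v + gdist ?E v (n - 1)"
      using R.gdist_ge_potential[of f v "n - 1"] lip that assms by simp
    moreover have "f (n - 1) = n - 2" unfolding f_def using assms by arith
    moreover have "gdist ?E v 1 \<le> ecc {..<n} ?E v" "gdist ?E v (n - 1) \<le> ecc {..<n} ?E v"
      using R.gdist_le_ecc assms by simp_all
    ultimately show ?thesis by linarith
  qed
  \<comment> \<open>Without the vertex \<open>2\<close>, the positions \<open>0, \<dots>, n - 2\<close> are each taken once; \<open>?g\<close> reads off the vertex.\<close>
  let ?g = "\<lambda>p::nat. if p = 0 then 1 else if p = 1 then 0 else p + 1"
  have f: "bij_betw f ({..<n} - {2}) {..n - 2}"
  proof (rule bij_betw_byWitness[where f' = ?g])
    show "\<forall>v\<in>{..<n} - {2}. ?g (f v) = v" unfolding f_def by auto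
    show "\<forall>p\<in>{..n - 2}. f (?g p) = p" unfolding f_def by auto
    show "f ` ({..<n} - {2}) \<subseteq> {..n - 2}"
    proof (rule image_subsetI)
      fix v assume "v \<in> {..<n} - {2}"
      then have "v < n" by simp
      then show "f v \<in> {..n - 2}" unfolding f_def atMost_iff using assms by arith
    qed
    show "?g ` {..n - 2} \<subseteq> {..<n} - {2}"
    proof (rule image_subsetI)
      fix p assume "p \<in> {..n - 2}"
      then have "p \<le> n - 2" by simp
      then have "?g p < n \<and> ?g p \<noteq> 2" using assms by arith
      then show "?g p \<in> {..<n} - {2}" by blast
    qed
  qed
  have "path_total (n - 2) + (n - 2)
      = (\<Sum>v\<in>{..<n} - {2}. max (f v) (n - 2 - f v)) + max (f 2) (n - 2 - f 2)"
    unfolding path_total_def using sum.reindex_bij_betw[OF f, of "\<lambda>i. max i (n - 2 - i)"]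
    by (simp add: f_def)
  also have "\<dots> = (\<Sum>v<n. max (f v) (n - 2 - f v))"
    using sum.remove[of "{..<n}" 2 "\<lambda>v. max (f v) (n - 2 - f v)"] assms by simp
  also have "\<dots> \<le> (\<Sum>v<n. ecc {..<n} ?E v)" using lower by (intro sum_mono) auto
  finally show ?thesis unfolding total_eccentricity_eq[OF con] V
    by (simp only: ereal_less_eq(3) of_nat_le_iff)
qed

theorem theorem4p10:
  fixes G :: "('a,'b) pre_digraph" and n :: nat
  assumes "n \<ge> 5"
    and "G \<in> connected_graphs_with_cut_vertices n (n - 3)"
  shows "total_eccentricity G \<le> total_eccentricity (U_graph n 3)"
proof -
  have G: "graph G" "connected G" "card (verts G) = n" "card {w. cut_vertex G w} = n - 3"
    using assms(2) by (auto simp: connected_graphs_with_cut_vertices_def)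
  interpret graph G by (rule G(1))
  interpret R: connected_relation "verts G" "arcs_ends G"
    using G(2) connected_iff_connected_relation[OF sym_arcs finite_verts] by simp
  have "{w. noncut (verts G) (arcs_ends G) w} = verts G - {w. cut_vertex G w}"
    using cut_vertex_iff G(3) assms(1) by (auto simp: noncut_def)
  moreover have "{w. cut_vertex G w} \<subseteq> verts G" by (auto simp: cut_vertex_def)
  ultimately have "card {w. noncut (verts G) (arcs_ends G) w} = 3"
    using G assms(1) by (simp add: card_Diff_subset finite_subset)
  then have "(\<Sum>v\<in>verts G. ecc (verts G) (arcs_ends G) v) \<le> path_total (n - 2) + (n - 2)"
    using R.total_ecc_le G(3) by simp
  then have "total_eccentricity G \<le> ereal (real (path_total (n - 2) + (n - 2)))"
    unfolding total_eccentricity_eq[OF G(2)]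
    by (simp only: ereal_less_eq(3) of_nat_le_iff)
  also have "\<dots> \<le> total_eccentricity (U_graph n 3)"
    using assms(1) by (rule total_eccentricity_U_graph)
  finally show ?thesis .
qed

end
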